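(* Let $(\mathcal X,\top,\Gamma,\Pi_r)$ be an associative geometry over a commutative unital ring $\mathbb K$. (i) Assume $\mathcal X$ admits a transversal pair, which we take as base point $(o^+,o^-)$. Then, letting $\mathbb A^+:=U_{o^-}$ and $\mathbb A^-:=U_{o^+}$, the pair of $\mathbb K$-modules $(\mathbb A^+,\mathbb A^-)$ with origins $o^+$, resp. $o^-$, becomes an associative pair when equipped with $$\langle xbz\rangle^+:=\Gamma(x,o^-,b,o^+,z),\qquad \langle ayc\rangle^-:=\Gamma(a,o^-,y,o^+,c)$$ ($x,z,y\in\mathbb A^+$, $a,b,c\in\mathbb A^-$). This construction is functorial: every homomorphism of associative geometries preserving base points restricts to a homomorphism of the corresponding associative pairs. (ii) Assume $\mathcal X$ admits a transversal triple $(a,b,c)$ (mutually transversal elements). Then the $\mathbb K$-module $\mathbb A:=U_c$ with origin $o^+:=a$ becomes an associative unital $\mathbb K$-algebra with unit $u:=b$ and product map $$\mathbb A\times\mathbb A\to\mathbb A,\quad (x,z)\mapsto xz:=\Gamma(x,a,u,c,z).$$ This construction is functorial (with respect to homomorphisms of associative geometries preserving the transversal triples).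
   Context: An associative geometry over $\mathbb K$ is a complete lattice $\mathcal X$ (join $\lor$, meet $\land$, least element $0$, greatest element $1$) with maps $\Gamma:\mathcal X^5\to\mathcal X$ and $\Pi_s:\mathcal X^3\to\mathcal X$ ($s\in\mathbb K$) satisfying axioms (1)–(6) below. Notation: $L_{xayb}(z):=M_{xabz}(y):=R_{aybz}(x):=\Gamma(x,a,y,b,z)$; $x\top y$ (transversal) iff $x\land y=0$ and $x\lor y=1$; $C_a=U_a=\{x: x\top a\}$, $C_{ab}=C_a\cap C_b$. (1) For all $x,y,z,u,v,a,b$: $\Gamma(\Gamma(x,a,y,b,z),a,u,b,v)=\Gamma(x,a,\Gamma(u,a,z,b,y),b,v)=\Gamma(x,a,y,b,\Gamma(z,a,u,b,v))$. (2) $\Gamma(x,a,y,b,z)=\Gamma(z,b,y,a,x)=\Gamma(a,x,y,z,b)$ for all $x,a,y,b,z$. (3) For all $x,a,y,b,z$ the pairs $(L_{xayb},L_{yaxb})$, $(M_{xabz},M_{zabx})$, $(R_{aybz},R_{azby})$ are structural, where a pair $g:\mathcal X\to\mathcal Y$, $h:\mathcal Y\to\mathcal X$ is structural if $g(\Gamma(x,h(u),y,h(v),z))=\Gamma(g(x),u,g(y),v,g(z))$ and $g(\Pi_r(x,h(u),y))=\Pi_r(g(x),u,g(y))$ for all $r\in\mathbb K$ and all arguments, and the same with $g$ and $h$ interchanged. (4) (i) $\Gamma(a,a,y,b,b)=a\lor b$ for all $a,b,y$; (ii) $\Gamma(a,b,y,a,b)=a\land b$ for all $a,b,y$; (iii)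 if $x\in C_{ab}$ then $\Gamma(x,a,x,b,z)=z=\Gamma(z,b,x,a,x)$; (iv) if $a\top x$, $y\top b$ then $\Gamma(x,a,y,b,b)=b$; (v) if $a\top y$, $b\top x$ then $\Gamma(x,a,y,b,a)=a$. (5) For all $a\in\mathcal X$, $r\in\mathbb K$: $C_a$ is stable under $\Pi_r$ (i.e. $(x,y)\mapsto\Pi_r(x,a,y)$), and $C_a$ is an affine space over $\mathbb K$ with additive torsor structure $x-y+z=\Gamma(x,a,y,a,z)$ and scalar action $(1-r)x+ry=\Pi_r(x,a,y)$. (6) For all $a,b$: $\Gamma(U_a,a,U_b,b,U_a)\subset U_a$ and $\Gamma(U_b,a,U_a,b,U_b)\subset U_b$. A choice of origin in the affine space $U_a$ makes it a $\mathbb K$-module. A base point is a fixed pair $(o^+,o^-)$ with $o^+\top o^-$. A homomorphism of associative geometries is a map $\phi$ with $\phi(\Gamma(x,a,y,b,z))=\Gamma(\phi x,\phi a,\phi y,\phi b,\phi z)$ and $\phi(\Pi_r(x,a,y))=\Pi_r(\phi x,\phi a,\phi y)$. An associative pair over $\mathbb K$ is a pair $(\mathbb A^+,\mathbb A^-)$ of $\mathbb K$-modules with trilinear maps $\langle\cdot,\cdot,\cdot\rangle^\pm:\mathbb A^\pm\times\mathbb A^\mp\times\mathbb A^\pm\to\mathbb A^\pm$ such that $\langle xy\langle zuv\rangle^\pm\rangle^\pm=\langle\langle xyz\rangle^\pm uv\rangle^\pm=\langle x\langle uzy\rangle^\mp v\rangle^\pm$. A homomorphism of associative pairs is a pair of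 $\mathbb K$-linear maps compatible with these products. *)

theory Defs
  imports "HOL-Algebra.Module"
begin

definition linear_maps ::
  "('k, 'r) ring_scheme \<Rightarrow> ('k, 'a, 'm) module_scheme \<Rightarrow> ('k, 'b, 'n) module_scheme \<Rightarrow> ('a \<Rightarrow> 'b) set"
  where
  "linear_maps K M N =
    {f. f \<in> carrier M \<rightarrow> carrier N \<and>
        (\<forall>x\<in>carrier M. \<forall>y\<in>carrier M. f (x \<oplus>\<^bsub>M\<^esub> y) = f x \<oplus>\<^bsub>N\<^esub> f y) \<and>
        (\<forall>r\<in>carrier K. \<forall>x\<in>carrier M. f (r \<odot>\<^bsub>M\<^esub> x) = r \<odot>\<^bsub>N\<^esub> f x)}"

text \<open>
  The module obtained from a set \<open>A\<close> with ternary operation \<open>t x y z\<close> (to be thought of as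
  \<open>x - y + z\<close>) and scalar action \<open>s r x y\<close> (to be thought of as \<open>(1 - r) x + r y\<close>) by choosing
  the origin \<open>e\<close>. The multiplicative fields of the record have no meaning for a module.
\<close>

definition pointed_module ::
  "'a set \<Rightarrow> ('a \<Rightarrow> 'a \<Rightarrow> 'a \<Rightarrow> 'a) \<Rightarrow> ('k \<Rightarrow> 'a \<Rightarrow> 'a \<Rightarrow> 'a) \<Rightarrow> 'a \<Rightarrow> ('k, 'a) module"
  where
  "pointed_module A t s e =
    \<lparr>carrier = A, mult = undefined, one = undefined, zero = e,
     add = (\<lambda>x z. t x e z), smult = (\<lambda>r x. s r e x)\<rparr>"

text \<open>The empty set counts as an affine space.\<close>

definition affine_space ::
  "('k, 'r) ring_scheme \<Rightarrow> 'a set \<Rightarrow> ('a \<Rightarrow> 'a \<Rightarrow> 'a \<Rightarrow> 'a) \<Rightarrow> ('k \<Rightarrow> 'a \<Rightarrow> 'a \<Rightarrow> 'a) \<Rightarrow> bool"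
  where
  "affine_space K A t s \<longleftrightarrow>
    (\<forall>e\<in>A. let M = pointed_module A t s e in
      module K M \<and>
      (\<forall>x\<in>A. \<forall>y\<in>A. \<forall>z\<in>A. t x y z = (x \<ominus>\<^bsub>M\<^esub> y) \<oplus>\<^bsub>M\<^esub> z) \<and>
      (\<forall>r\<in>carrier K. \<forall>x\<in>A. \<forall>y\<in>A.
        s r x y = ((\<one>\<^bsub>K\<^esub> \<ominus>\<^bsub>K\<^esub> r) \<odot>\<^bsub>M\<^esub> x) \<oplus>\<^bsub>M\<^esub> (r \<odot>\<^bsub>M\<^esub> y)))"

text \<open>The library's locale \<open>algebra\<close> is restricted to commutative algebras.\<close>

locale assoc_unital_algebra = module K A + ring A
  for K :: "('k, 'r) ring_scheme" (structure) and A :: "('k, 'a, 'm) module_scheme" (structure) +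
  assumes smult_mult_left:
      "\<lbrakk>r \<in> carrier K; x \<in> carrier A; y \<in> carrier A\<rbrakk> \<Longrightarrow>
        (r \<odot>\<^bsub>A\<^esub> x) \<otimes>\<^bsub>A\<^esub> y = r \<odot>\<^bsub>A\<^esub> (x \<otimes>\<^bsub>A\<^esub> y)"
    and smult_mult_right:
      "\<lbrakk>r \<in> carrier K; x \<in> carrier A; y \<in> carrier A\<rbrakk> \<Longrightarrow>
        x \<otimes>\<^bsub>A\<^esub> (r \<odot>\<^bsub>A\<^esub> y) = r \<odot>\<^bsub>A\<^esub> (x \<otimes>\<^bsub>A\<^esub> y)"

definition algebra_homs ::
  "('k, 'r) ring_scheme \<Rightarrow> ('k, 'a, 'm) module_scheme \<Rightarrow> ('k, 'b, 'n) module_scheme \<Rightarrow> ('a \<Rightarrow> 'b) set"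
  where "algebra_homs K A B = linear_maps K A B \<inter> ring_hom A B"

definition trilinear ::
  "('k, 'r) ring_scheme \<Rightarrow> ('k, 'a, 'm1) module_scheme \<Rightarrow> ('k, 'b, 'm2) module_scheme \<Rightarrow>
   ('k, 'c, 'm3) module_scheme \<Rightarrow> ('k, 'd, 'm4) module_scheme \<Rightarrow> ('a \<Rightarrow> 'b \<Rightarrow> 'c \<Rightarrow> 'd) \<Rightarrow> bool"
  where
  "trilinear K A B C D t \<longleftrightarrow>
    (\<forall>y\<in>carrier B. \<forall>z\<in>carrier C. (\<lambda>x. t x y z) \<in> linear_maps K A D) \<and>
    (\<forall>x\<in>carrier A. \<forall>z\<in>carrier C. (\<lambda>y. t x y z) \<in> linear_maps K B D) \<and>
    (\<forall>x\<in>carrier A. \<forall>y\<in>carrier B. (\<lambda>z. t x y z) \<in> linear_maps K C D)"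

definition pair_identity ::
  "'a set \<Rightarrow> 'b set \<Rightarrow> ('a \<Rightarrow> 'b \<Rightarrow> 'a \<Rightarrow> 'a) \<Rightarrow> ('b \<Rightarrow> 'a \<Rightarrow> 'b \<Rightarrow> 'b) \<Rightarrow> bool"
  where
  "pair_identity A B t t' \<longleftrightarrow>
    (\<forall>x\<in>A. \<forall>y\<in>B. \<forall>z\<in>A. \<forall>u\<in>B. \<forall>v\<in>A.
      t x y (t z u v) = t (t x y z) u v \<and> t (t x y z) u v = t x (t' u z y) v)"

definition associative_pair ::
  "('k, 'r) ring_scheme \<Rightarrow> ('k, 'a, 'm) module_scheme \<Rightarrow> ('k, 'b, 'n) module_scheme \<Rightarrow>
   ('a \<Rightarrow> 'b \<Rightarrow> 'a \<Rightarrow> 'a) \<Rightarrow> ('b \<Rightarrow> 'a \<Rightarrow> 'b \<Rightarrow> 'b) \<Rightarrow> bool"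
  where
  "associative_pair K Ap Am tp tm \<longleftrightarrow>
    module K Ap \<and> module K Am \<and>
    trilinear K Ap Am Ap Ap tp \<and> trilinear K Am Ap Am Am tm \<and>
    pair_identity (carrier Ap) (carrier Am) tp tm \<and>
    pair_identity (carrier Am) (carrier Ap) tm tp"

definition associative_pair_hom ::
  "('k, 'r) ring_scheme \<Rightarrow>
   ('k, 'a, 'm1) module_scheme \<Rightarrow> ('k, 'b, 'm2) module_scheme \<Rightarrow>
   ('a \<Rightarrow> 'b \<Rightarrow> 'a \<Rightarrow> 'a) \<Rightarrow> ('b \<Rightarrow> 'a \<Rightarrow> 'b \<Rightarrow> 'b) \<Rightarrow>
   ('k, 'c, 'm3) module_scheme \<Rightarrow> ('k, 'd, 'm4) module_scheme \<Rightarrow>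
   ('c \<Rightarrow> 'd \<Rightarrow> 'c \<Rightarrow> 'c) \<Rightarrow> ('d \<Rightarrow> 'c \<Rightarrow> 'd \<Rightarrow> 'd) \<Rightarrow>
   ('a \<Rightarrow> 'c) \<Rightarrow> ('b \<Rightarrow> 'd) \<Rightarrow> bool"
  where
  "associative_pair_hom K Ap Am tp tm Bp Bm sp sm f g \<longleftrightarrow>
    f \<in> linear_maps K Ap Bp \<and> g \<in> linear_maps K Am Bm \<and>
    (\<forall>x\<in>carrier Ap. \<forall>y\<in>carrier Am. \<forall>z\<in>carrier Ap. f (tp x y z) = sp (f x) (g y) (f z)) \<and>
    (\<forall>x\<in>carrier Am. \<forall>y\<in>carrier Ap. \<forall>z\<in>carrier Am. g (tm x y z) = sm (g x) (f y) (g z))"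

type_synonym 'x quintary = "'x \<Rightarrow> 'x \<Rightarrow> 'x \<Rightarrow> 'x \<Rightarrow> 'x \<Rightarrow> 'x"
type_synonym ('k, 'x) dilation = "'k \<Rightarrow> 'x \<Rightarrow> 'x \<Rightarrow> 'x \<Rightarrow> 'x"

definition transversal :: "'x::complete_lattice \<Rightarrow> 'x \<Rightarrow> bool"
  where "transversal x y \<longleftrightarrow>
    inf_class.inf x y = Orderings.bot \<and> sup_class.sup x y = Orderings.top"

definition U :: "'x::complete_lattice \<Rightarrow> 'x set"
  where "U a = {x. transversal x a}"

definition semistructural ::
  "('k, 'r) ring_scheme \<Rightarrow> 'x quintary \<Rightarrow> ('k, 'x) dilation \<Rightarrow> 'y quintary \<Rightarrow> ('k, 'y) dilation \<Rightarrow>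
   ('x \<Rightarrow> 'y) \<Rightarrow> ('y \<Rightarrow> 'x) \<Rightarrow> bool"
  where
  "semistructural K \<Gamma> P \<Gamma>' P' g h \<longleftrightarrow>
    (\<forall>x u y v z. g (\<Gamma> x (h u) y (h v) z) = \<Gamma>' (g x) u (g y) v (g z)) \<and>
    (\<forall>r\<in>carrier K. \<forall>x u y. g (P r x (h u) y) = P' r (g x) u (g y))"

definition structural ::
  "('k, 'r) ring_scheme \<Rightarrow> 'x quintary \<Rightarrow> ('k, 'x) dilation \<Rightarrow> 'y quintary \<Rightarrow> ('k, 'y) dilation \<Rightarrow>
   ('x \<Rightarrow> 'y) \<Rightarrow> ('y \<Rightarrow> 'x) \<Rightarrow> bool"
  where
  "structural K \<Gamma> P \<Gamma>' P' g h \<longleftrightarrow>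
    semistructural K \<Gamma> P \<Gamma>' P' g h \<and> semistructural K \<Gamma>' P' \<Gamma> P h g"

text \<open>
  \<open>P r x a y\<close> stands for \<open>\<Pi>\<^sub>r(x,a,y)\<close>; its values for \<open>r\<close> outside the carrier of \<open>K\<close> are
  irrelevant. In \<open>structural_L\<close>, \<open>structural_M\<close>, \<open>structural_R\<close> the pairs are
  \<open>(L\<^bsub>xayb\<^esub>, L\<^bsub>yaxb\<^esub>)\<close>, \<open>(M\<^bsub>xabz\<^esub>, M\<^bsub>zabx\<^esub>)\<close> and \<open>(R\<^bsub>aybz\<^esub>, R\<^bsub>azby\<^esub>)\<close>, where
  \<open>L\<^bsub>xayb\<^esub>(z) = M\<^bsub>xabz\<^esub>(y) = R\<^bsub>aybz\<^esub>(x) = \<Gamma>(x,a,y,b,z)\<close>.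
\<close>

locale associative_geometry = cring K
  for K :: "('k, 'r) ring_scheme" (structure) +
  fixes \<Gamma> :: "('x::complete_lattice) quintary"
    and P :: "('k, 'x) dilation"
  assumes assoc_left:
      "\<Gamma> (\<Gamma> x a y b z) a u b v = \<Gamma> x a (\<Gamma> u a z b y) b v"
    and assoc_right:
      "\<Gamma> x a (\<Gamma> u a z b y) b v = \<Gamma> x a y b (\<Gamma> z a u b v)"
    and symm_reverse: "\<Gamma> x a y b z = \<Gamma> z b y a x"
    and symm_exchange: "\<Gamma> z b y a x = \<Gamma> a x y z b"
    and structural_L:
      "structural K \<Gamma> P \<Gamma> P (\<lambda>z. \<Gamma> x a y b z) (\<lambda>z. \<Gamma> y a x b z)"
    and structural_M:
      "structural K \<Gamma> P \<Gamma> P (\<lambda>y. \<Gamma> x a y b z) (\<lambda>y. \<Gamma> z a y b x)"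
    and structural_R:
      "structural K \<Gamma> P \<Gamma> P (\<lambda>x. \<Gamma> x a y b z) (\<lambda>x. \<Gamma> x a z b y)"
    and diag_join: "\<Gamma> a a y b b = sup_class.sup a b"
    and diag_meet: "\<Gamma> a b y a b = inf_class.inf a b"
    and diag_unit_left: "x \<in> U a \<inter> U b \<Longrightarrow> \<Gamma> x a x b z = z"
    and diag_unit_right: "x \<in> U a \<inter> U b \<Longrightarrow> \<Gamma> z b x a x = z"
    and diag_right: "\<lbrakk>transversal a x; transversal y b\<rbrakk> \<Longrightarrow> \<Gamma> x a y b b = b"
    and diag_outer: "\<lbrakk>transversal a y; transversal b x\<rbrakk> \<Longrightarrow> \<Gamma> x a y b a = a"
    and dilation_stable:
      "\<lbrakk>r \<in> carrier K; x \<in> U a; y \<in> U a\<rbrakk> \<Longrightarrow> P r x a y \<in> U a"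
    and affine:
      "affine_space K (U a) (\<lambda>x y z. \<Gamma> x a y a z) (\<lambda>r x y. P r x a y)"
    and stable_fst: "\<lbrakk>x \<in> U a; y \<in> U b; z \<in> U a\<rbrakk> \<Longrightarrow> \<Gamma> x a y b z \<in> U a"
    and stable_snd: "\<lbrakk>x \<in> U b; y \<in> U a; z \<in> U b\<rbrakk> \<Longrightarrow> \<Gamma> x a y b z \<in> U b"

definition geometry_hom ::
  "('k, 'r) ring_scheme \<Rightarrow> 'x quintary \<Rightarrow> ('k, 'x) dilation \<Rightarrow> 'y quintary \<Rightarrow> ('k, 'y) dilation \<Rightarrow>
   ('x \<Rightarrow> 'y) \<Rightarrow> bool"
  where
  "geometry_hom K \<Gamma> P \<Gamma>' P' \<phi> \<longleftrightarrow>
    (\<forall>x a y b z. \<phi> (\<Gamma> x a y b z) = \<Gamma>' (\<phi> x) (\<phi> a) (\<phi> y) (\<phi> b) (\<phi> z)) \<and>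
    (\<forall>r\<in>carrier K. \<forall>x a y. \<phi> (P r x a y) = P' r (\<phi> x) (\<phi> a) (\<phi> y))"

definition U_module ::
  "('x::complete_lattice) quintary \<Rightarrow> ('k, 'x) dilation \<Rightarrow> 'x \<Rightarrow> 'x \<Rightarrow> ('k, 'x) module"
  where
  "U_module \<Gamma> P a e = pointed_module (U a) (\<lambda>x y z. \<Gamma> x a y a z) (\<lambda>r x y. P r x a y) e"

definition transversal_triple :: "'x::complete_lattice \<Rightarrow> 'x \<Rightarrow> 'x \<Rightarrow> bool"
  where "transversal_triple a b c \<longleftrightarrow> transversal a b \<and> transversal b c \<and> transversal a c"

definition triple_algebra ::
  "('x::complete_lattice) quintary \<Rightarrow> ('k, 'x) dilation \<Rightarrow> 'x \<Rightarrow> 'x \<Rightarrow> 'x \<Rightarrow> ('k, 'x) module"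
  where
  "triple_algebra \<Gamma> P a b c =
    (U_module \<Gamma> P c a)\<lparr>mult := (\<lambda>x z. \<Gamma> x a b c z), one := b\<rparr>"

end

theory Submission
  imports Defs
begin

text \<open>
  All linearity comes from one observation: if \<open>(g, h)\<close> is a structural pair with \<open>h a' = a\<close> and
  \<open>g e = e'\<close>, then \<open>g\<close> is linear from \<open>U a\<close> with origin \<open>e\<close> to \<open>U a'\<close> with origin \<open>e'\<close>. For the left,
  middle and right multiplications built from a transversal pair the diagonal-value axioms
  supply exactly these values. Homomorphisms preserve transversality because joins and meets are
  values of \<open>\<Gamma>\<close> and bottom and top are the meet and the join of the base points. The algebra
  product of a transversal triple is the product \<open>\<langle>z b x\<rangle>\<close> of the associative pair with its middle
  argument fixed at the third element \<open>b\<close>.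
\<close>

lemma transversal_sym: "transversal x y \<longleftrightarrow> transversal y x"
  by (simp add: transversal_def inf.commute sup.commute)

lemma U_iff: "x \<in> U a \<longleftrightarrow> transversal x a"
  by (simp add: U_def)

lemma U_module_simps [simp]:
  "carrier (U_module \<Gamma> P a e) = U a"
  "zero (U_module \<Gamma> P a e) = e"
  "add (U_module \<Gamma> P a e) = (\<lambda>x z. \<Gamma> x a e a z)"
  "smult (U_module \<Gamma> P a e) = (\<lambda>r x. P r e a x)"
  by (simp_all add: U_module_def pointed_module_def)

lemma triple_algebra_simps [simp]:
  "carrier (triple_algebra \<Gamma> P a b c) = U c"
  "zero (triple_algebra \<Gamma> P a b c) = a"
  "add (triple_algebra \<Gamma> P a b c) = (\<lambda>x z. \<Gamma> x c a c z)"
  "smult (triple_algebra \<Gamma> P a b c) = (\<lambda>r x. P r a c x)"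
  "mult (triple_algebra \<Gamma> P a b c) = (\<lambda>x z. \<Gamma> x a b c z)"
  "one (triple_algebra \<Gamma> P a b c) = b"
  by (simp_all add: triple_algebra_def U_module_def pointed_module_def)

text \<open>In these modules the sum and the scalar multiple are \<open>\<Gamma> x a e a z\<close>
  and \<open>P r e a x\<close>. The semistructural identities at \<open>u = v = a'\<close>, with
  \<open>e\<close> as base argument, therefore read as additivity and homogeneity.\<close>

lemma structural_linear:
  assumes "structural K \<Gamma> P \<Gamma>' P' g h" and "h a' = a" and "g e = e'"
    and "\<And>x. x \<in> U a \<Longrightarrow> g x \<in> U a'"
  shows "g \<in> linear_maps K (U_module \<Gamma> P a e) (U_module \<Gamma>' P' a' e')"
proof -
  have "g (\<Gamma> x a y a z) = \<Gamma>' (g x) a' (g y) a' (g z)" for x y z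
    using assms(1,2) unfolding structural_def semistructural_def by metis
  moreover have "g (P r x a y) = P' r (g x) a' (g y)" if "r \<in> carrier K" for r x y
    using assms(1,2) that unfolding structural_def semistructural_def by metis
  ultimately show ?thesis
    using assms(3,4) by (simp add: linear_maps_def)
qed

context associative_geometry
begin

lemma U_module_module: "e \<in> U a \<Longrightarrow> module K (U_module \<Gamma> P a e)"
  using affine[of a] unfolding affine_space_def U_module_def Let_def by blast

lemma exchange: "\<Gamma> x a y b z = \<Gamma> a x y z b"
  using symm_reverse symm_exchange by metis

lemma pair_linear_right:
  assumes "transversal op om" and "x \<in> U om" and "b \<in> U op"
  shows "(\<lambda>z. \<Gamma> x om b op z) \<in> linear_maps K (U_module \<Gamma> P om op) (U_module \<Gamma> P om op)"
proof (rule structural_linear[OF structural_L])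
  show "\<Gamma> b om x op om = om"
    using assms by (intro diag_outer) (auto simp: U_iff transversal_sym)
  show "\<Gamma> x om b op op = op"
    using assms by (intro diag_right) (auto simp: U_iff transversal_sym)
qed (use assms in \<open>auto intro: stable_fst\<close>)

lemma pair_linear_left:
  assumes "transversal op om" and "z \<in> U om" and "b \<in> U op"
  shows "(\<lambda>x. \<Gamma> x om b op z) \<in> linear_maps K (U_module \<Gamma> P om op) (U_module \<Gamma> P om op)"
proof -
  \<comment> \<open>Reversal turns right multiplication into a left multiplication with
    \<open>op\<close> and \<open>om\<close> exchanged, so the two diagonal axioms trade
    roles.\<close>
  have "(\<lambda>x. \<Gamma> z op b om x) \<in> linear_maps K (U_module \<Gamma> P om op) (U_module \<Gamma> P om op)"
  proof (rule structural_linear[OF structural_L])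
    show "\<Gamma> b op z om om = om"
      using assms by (intro diag_right) (auto simp: U_iff transversal_sym)
    show "\<Gamma> z op b om op = op"
      using assms by (intro diag_outer) (auto simp: U_iff transversal_sym)
  qed (use assms in \<open>auto intro: stable_snd\<close>)
  then show ?thesis
    by (simp add: symm_reverse[of _ om b op z])
qed

lemma pair_linear_middle:
  assumes "transversal op om" and "x \<in> U om" and "z \<in> U om"
  shows "(\<lambda>b. \<Gamma> x om b op z) \<in> linear_maps K (U_module \<Gamma> P op om) (U_module \<Gamma> P om op)"
proof (rule structural_linear[OF structural_M])
  \<comment> \<open>The exchange symmetry rewrites \<open>\<Gamma> x om om op z\<close> as
    \<open>\<Gamma> om x om z op\<close>, where the unit law applies with \<open>om\<close> as the
    repeated point.\<close>
  have "om \<in> U x" "om \<in> U z"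
    using assms by (auto simp: U_iff transversal_sym)
  then show "\<Gamma> z om om op x = op" "\<Gamma> x om om op z = op"
    by (simp_all add: exchange[of _ om] diag_unit_left)
qed (use assms in \<open>auto intro: stable_fst\<close>)

lemma pair_trilinear:
  assumes "transversal op om"
  shows "trilinear K (U_module \<Gamma> P om op) (U_module \<Gamma> P op om) (U_module \<Gamma> P om op)
    (U_module \<Gamma> P om op) (\<lambda>x b z. \<Gamma> x om b op z)"
  using assms by (simp add: trilinear_def pair_linear_left pair_linear_middle pair_linear_right)

lemma pair_identity_Gamma:
  "pair_identity A B (\<lambda>x y z. \<Gamma> x a y b z) (\<lambda>x y z. \<Gamma> x a y b z)"
  by (simp add: pair_identity_def assoc_left assoc_right)

lemma associative_pair:
  assumes "transversal op om"
  shows "associative_pair K (U_module \<Gamma> P om op) (U_module \<Gamma> P op om)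
    (\<lambda>x b z. \<Gamma> x om b op z) (\<lambda>a y c. \<Gamma> a om y op c)"
proof -
  have om: "transversal om op"
    using assms by (simp add: transversal_sym)
  \<comment> \<open>Exchanging the base points gives the product with \<open>op\<close> and
    \<open>om\<close> in the wrong slots. Trilinearity survives swapping the outer arguments, and
    reversal then restores the slots.\<close>
  have "trilinear K (U_module \<Gamma> P op om) (U_module \<Gamma> P om op) (U_module \<Gamma> P op om)
      (U_module \<Gamma> P op om) (\<lambda>a y c. \<Gamma> c op y om a)"
    using pair_trilinear[OF om] by (simp add: trilinear_def)
  then have "trilinear K (U_module \<Gamma> P op om) (U_module \<Gamma> P om op) (U_module \<Gamma> P op om)
      (U_module \<Gamma> P op om) (\<lambda>a y c. \<Gamma> a om y op c)"
    by (simp add: symm_reverse[of _ om _ op])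
  then show ?thesis
    using assms om
    by (simp add: associative_pair_def U_module_module U_iff pair_trilinear pair_identity_Gamma)
qed

lemma assoc_unital_algebra:
  assumes "transversal_triple a b c"
  shows "assoc_unital_algebra K (triple_algebra \<Gamma> P a b c)"
proof -
  let ?A = "triple_algebra \<Gamma> P a b c"
  have ac: "transversal a c" and b: "b \<in> U a" "b \<in> U c" and a: "a \<in> U c"
    using assms by (auto simp: transversal_triple_def U_iff transversal_sym)
  have closed: "\<Gamma> x a b c z \<in> U c" if "x \<in> U c" "z \<in> U c" for x z
    using that b by (intro stable_snd)
  \<comment> \<open>By reversal the product \<open>xz\<close> equals
    \<open>\<Gamma> z c b a x\<close>, the pair product for the base point \<open>(a, c)\<close> in
    opposite order. Hence left multiplication uses \<open>pair_linear_left\<close>.\<close>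
  have lin1: "(\<lambda>z. \<Gamma> x a b c z) \<in> linear_maps K (U_module \<Gamma> P c a) (U_module \<Gamma> P c a)"
    if "x \<in> U c" for x
    using pair_linear_left[OF ac that b(1)] by (simp add: symm_reverse[of x a b c])
  have lin2: "(\<lambda>x. \<Gamma> x a b c z) \<in> linear_maps K (U_module \<Gamma> P c a) (U_module \<Gamma> P c a)"
    if "z \<in> U c" for z
    using pair_linear_right[OF ac that b(1)] by (simp add: symm_reverse[of _ a b c z])
  interpret M: module K "U_module \<Gamma> P c a"
    by (rule U_module_module[OF a])
  \<comment> \<open>The record update changes only \<open>mult\<close> and \<open>one\<close>, which
    the module axioms do not read.\<close>
  have mod: "module K ?A"
    using M.module_axioms
    by (simp add: module_def module_axioms_def abelian_group_def abelian_group_axioms_def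
        abelian_monoid_def triple_algebra_def)
  interpret A: module K ?A
    by (rule mod)
  have "ring ?A"
  proof (rule ringI)
    \<comment> \<open>Associativity is para-associativity with both middle points equal to
      \<open>b\<close>; the unit laws hold because \<open>b\<close> lies in both \<open>U a\<close>
      and \<open>U c\<close>.\<close>
    show "monoid ?A"
      using b closed by unfold_locales
        (simp_all add: assoc_left assoc_right diag_unit_left diag_unit_right)
  next
    fix x y z assume "x \<in> carrier ?A" "y \<in> carrier ?A" "z \<in> carrier ?A"
    then show "(x \<oplus>\<^bsub>?A\<^esub> y) \<otimes>\<^bsub>?A\<^esub> z = x \<otimes>\<^bsub>?A\<^esub> z \<oplus>\<^bsub>?A\<^esub> y \<otimes>\<^bsub>?A\<^esub> z"
      and "z \<otimes>\<^bsub>?A\<^esub> (x \<oplus>\<^bsub>?A\<^esub> y) = z \<otimes>\<^bsub>?A\<^esub> x \<oplus>\<^bsub>?A\<^esub> z \<otimes>\<^bsub>?A\<^esub> y"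
      using lin1[of z] lin2[of z] by (simp_all add: linear_maps_def)
  qed (rule A.abelian_group_axioms)
  then show ?thesis
    using mod lin1 lin2
    by (simp add: assoc_unital_algebra_def assoc_unital_algebra_axioms_def linear_maps_def)
qed

end

text \<open>The reference pair \<open>e\<close>, \<open>a\<close> determines the images of bottom
  and top: \<open>\<phi>\<close> sends the meet and join of \<open>e\<close> and \<open>a\<close> to
  those of \<open>\<phi> e\<close> and \<open>\<phi> a\<close>, which are again bottom and
  top.\<close>

lemma geometry_hom_transversal:
  assumes "associative_geometry K \<Gamma> P" and "associative_geometry K \<Gamma>' P'"
    and "geometry_hom K \<Gamma> P \<Gamma>' P' \<phi>"
    and "transversal x a" and "transversal e a" and "transversal (\<phi> e) (\<phi> a)"
  shows "transversal (\<phi> x) (\<phi> a)"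
proof -
  interpret G: associative_geometry K \<Gamma> P by fact
  interpret G': associative_geometry K \<Gamma>' P' by fact
  have hom: "\<phi> (\<Gamma> x a y b z) = \<Gamma>' (\<phi> x) (\<phi> a) (\<phi> y) (\<phi> b) (\<phi> z)" for x a y b z
    using assms(3) by (simp add: geometry_hom_def)
  have "\<phi> (inf_class.inf x y) = inf_class.inf (\<phi> x) (\<phi> y)"
    and "\<phi> (sup_class.sup x y) = sup_class.sup (\<phi> x) (\<phi> y)" for x y
    using hom G.diag_meet G'.diag_meet G.diag_join G'.diag_join by metis+
  then show ?thesis
    using assms(4-6) unfolding transversal_def by metis
qed

lemma geometry_hom_linear:
  assumes "associative_geometry K \<Gamma> P" and "associative_geometry K \<Gamma>' P'"
    and "geometry_hom K \<Gamma> P \<Gamma>' P' \<phi>"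
    and "transversal e a" and "transversal (\<phi> e) (\<phi> a)"
  shows "restrict \<phi> (U a) \<in> linear_maps K (U_module \<Gamma> P a e) (U_module \<Gamma>' P' (\<phi> a) (\<phi> e))"
proof -
  interpret G: associative_geometry K \<Gamma> P by fact
  \<comment> \<open>Module closure keeps sums and multiples in \<open>U a\<close>, where
    \<open>restrict \<phi> (U a)\<close> agrees with \<open>\<phi>\<close>.\<close>
  interpret M: module K "U_module \<Gamma> P a e"
    using assms(4) by (intro G.U_module_module) (simp add: U_iff)
  show ?thesis
    using assms(3) geometry_hom_transversal[OF assms(1-3) _ assms(4,5)] M.a_closed M.smult_closed
    by (simp add: linear_maps_def geometry_hom_def U_iff)
qed

lemma associative_pair_hom_restrict:
  assumes "associative_geometry K \<Gamma> P" and "associative_geometry K \<Gamma>' P'"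
    and hom: "geometry_hom K \<Gamma> P \<Gamma>' P' \<phi>"
    and "transversal op om" and "transversal (\<phi> op) (\<phi> om)"
  shows "associative_pair_hom K
    (U_module \<Gamma> P om op) (U_module \<Gamma> P op om)
    (\<lambda>x b z. \<Gamma> x om b op z) (\<lambda>a y c. \<Gamma> a om y op c)
    (U_module \<Gamma>' P' (\<phi> om) (\<phi> op)) (U_module \<Gamma>' P' (\<phi> op) (\<phi> om))
    (\<lambda>x b z. \<Gamma>' x (\<phi> om) b (\<phi> op) z) (\<lambda>a y c. \<Gamma>' a (\<phi> om) y (\<phi> op) c)
    (restrict \<phi> (U om)) (restrict \<phi> (U op))"
proof -
  interpret G: associative_geometry K \<Gamma> P by fact
  \<comment> \<open>The swapped pairs yield linearity of the restriction to
    \<open>U op\<close>.\<close>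
  have "transversal om op" "transversal (\<phi> om) (\<phi> op)"
    using assms(4,5) by (simp_all add: transversal_sym)
  then show ?thesis
    using assms(4,5) hom geometry_hom_linear[OF assms(1-3)]
    by (simp add: associative_pair_hom_def G.stable_fst G.stable_snd geometry_hom_def)
qed

lemma algebra_hom_restrict:
  assumes "associative_geometry K \<Gamma> P" and "associative_geometry K \<Gamma>' P'"
    and hom: "geometry_hom K \<Gamma> P \<Gamma>' P' \<phi>"
    and t: "transversal_triple a b c" and t': "transversal_triple (\<phi> a) (\<phi> b) (\<phi> c)"
  shows "restrict \<phi> (U c) \<in>
    algebra_homs K (triple_algebra \<Gamma> P a b c) (triple_algebra \<Gamma>' P' (\<phi> a) (\<phi> b) (\<phi> c))"
proof -
  interpret G: associative_geometry K \<Gamma> P by fact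
  \<comment> \<open>\<open>b \<in> U a\<close> keeps products in \<open>U c\<close>, and
    \<open>b \<in> U c\<close> makes the restriction send the unit to
    \<open>\<phi> b\<close>.\<close>
  have "b \<in> U a" "b \<in> U c" "transversal a c" "transversal (\<phi> a) (\<phi> c)"
    using t t' by (auto simp: transversal_triple_def U_iff transversal_sym)
  then show ?thesis
    using hom geometry_hom_linear[OF assms(1-3), of a c]
    by (auto simp: algebra_homs_def linear_maps_def ring_hom_def G.stable_snd geometry_hom_def)
qed

theorem theorem3p3:
  fixes K :: "('k, 'r) ring_scheme"
    and \<Gamma> :: "('x::complete_lattice) quintary"
    and P :: "('k, 'x) dilation"
  assumes "associative_geometry K \<Gamma> P"
  shows
    "(\<forall>op om. transversal op om \<longrightarrow>
        associative_pair K (U_module \<Gamma> P om op) (U_module \<Gamma> P op om)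
          (\<lambda>x b z. \<Gamma> x om b op z) (\<lambda>a y c. \<Gamma> a om y op c))
     \<and>
     (\<forall>op om (\<Gamma>' :: ('y::complete_lattice) quintary) P' op' om' \<phi>.
        transversal op om \<and> associative_geometry K \<Gamma>' P' \<and> transversal op' om' \<and>
        geometry_hom K \<Gamma> P \<Gamma>' P' \<phi> \<and> \<phi> op = op' \<and> \<phi> om = om' \<longrightarrow>
        associative_pair_hom K
          (U_module \<Gamma> P om op) (U_module \<Gamma> P op om)
          (\<lambda>x b z. \<Gamma> x om b op z) (\<lambda>a y c. \<Gamma> a om y op c)
          (U_module \<Gamma>' P' om' op') (U_module \<Gamma>' P' op' om')
          (\<lambda>x b z. \<Gamma>' x om' b op' z) (\<lambda>a y c. \<Gamma>' a om' y op' c)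
          (restrict \<phi> (U om)) (restrict \<phi> (U op)))
     \<and>
     (\<forall>a b c. transversal_triple a b c \<longrightarrow>
        assoc_unital_algebra K (triple_algebra \<Gamma> P a b c))
     \<and>
     (\<forall>a b c (\<Gamma>' :: 'y quintary) P' a' b' c' \<phi>.
        transversal_triple a b c \<and> associative_geometry K \<Gamma>' P' \<and> transversal_triple a' b' c' \<and>
        geometry_hom K \<Gamma> P \<Gamma>' P' \<phi> \<and> \<phi> a = a' \<and> \<phi> b = b' \<and> \<phi> c = c' \<longrightarrow>
        restrict \<phi> (U c) \<in> algebra_homs K (triple_algebra \<Gamma> P a b c) (triple_algebra \<Gamma>' P' a' b' c'))"
proof -
  interpret associative_geometry K \<Gamma> P by fact
  show ?thesis
    using associative_pair assoc_unital_algebra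
      associative_pair_hom_restrict[OF assms] algebra_hom_restrict[OF assms]
    by blast
qed

end
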